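(* Let $A=KQ/I$ be an almost gentle algebra with set of maximal paths $\mathcal M$, and let $T(A)=KQ_{T(A)}/I_{T(A)}$ be the trivial extension of $A$ by $D(A)=\operatorname{Hom}_K(A,K)$, where the set of new arrows of $Q_{T(A)}$ is $D=\{\beta_m\mid m\in\mathcal M\}$. Then $D$ is an admissible cut of $Q_{T(A)}$ and the cut algebra $KQ_{T(A)}/\langle I_{T(A)}\cup D\rangle$ associated to $D$ is isomorphic to $A$.
   Context: $K$ is a field; all algebras are indecomposable and finite dimensional over $K$. Quivers are finite, $Q_0$ and $Q_1$ denote vertices and arrows; $ab$ denotes the arrow $a$ followed by the arrow $b$ (and is $0$ if not composable). For a presentation $KQ/I$ the ideal $I$ is admissible. An algebra is almost gentle if it is Morita equivalent to some $KQ/I$ such that (S0) $I$ is generated by paths of length 2, and (S1) for every $a\in Q_1$ there is at most one arrow $b$ with $ab\notin I$ and at most one arrow $c$ with $ca\notin I$. "Let $A=KQ/I$ be almost gentle" means that the presentation satisfies (S0) and (S1). A path $p$ in $Q$ is a maximal path of $A$ if $p\notin I$ and $ap\in I$ and $pa\in I$ for every arrow $a\in Q_1$. Presentation of $T(A)$: the trivial extension of $A$ by $D(A)$ (the vector space $A\oplus D(A)$ with $(a,f)(b,g)=(ab,ag+fb)$, $(afb)(x)=f(bxa)$) is presented as follows. The quiver $Q_{T(A)}$ has the same vertices as $Q$, and its arrows are those of $Q$ together with, for each $m\in\mathcal M$, a new arrow $\beta_m$ from the end vertex of $m$ to the start vertex of $m$. Let $\mathcal S$ be the set of all cyclic permutations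 of the cycles $m\beta_m$, $m\in\mathcal M$ (the special cycles). $I_{T(A)}$ is generated by: $C-C'$ for $C,C'\in\mathcal S$ at the same vertex; $Ca$ for $C\in\mathcal S$ with first arrow $a$; and $ab$ for arrows $a,b$ of $Q_{T(A)}$ such that $ab$ is not a subpath of any $C\in\mathcal S$. Call two cycles in $\mathcal S$ equivalent if one is a cyclic permutation of the other, and let $C_1,\dots,C_t$ be representatives of the equivalence classes. An admissible cut of $Q_{T(A)}$ is a set of arrows of $Q_{T(A)}$ consisting of exactly one arrow from each $C_i$, $i=1,\dots,t$. $\langle X\rangle$ denotes the ideal generated by $X$. *)

theory Defs
  imports
    "HOL-Algebra.Module"
    "HOL-Algebra.QuotRing"
    "HOL-Algebra.Ideal_Product"
    "HOL-Library.Poly_Mapping"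
    "HOL-Library.Sublist"
    "Graph_Theory.Arc_Walk"
begin

section \<open>Path algebras\<close>

text \<open>
  Quivers are directed multigraphs (finite ones: \<^locale>\<open>fin_digraph\<close>), and the field \<open>K\<close> is a
  type of class \<^class>\<open>field\<close>. A path is its start vertex together with its list of arrows
  in the order of traversal; the start vertex distinguishes the trivial paths.
\<close>

type_synonym ('v, 'a) path = "'v \<times> 'a list"

definition path_end :: "('v, 'a) pre_digraph \<Rightarrow> ('v, 'a) path \<Rightarrow> 'v" where
  "path_end Q p = pre_digraph.awlast Q (fst p) (snd p)"

definition paths :: "('v, 'a) pre_digraph \<Rightarrow> ('v, 'a) path set" where
  "paths Q = {p. pre_digraph.awalk Q (fst p) (snd p) (path_end Q p)}"

definition path_mult ::
  "('v, 'a) pre_digraph \<Rightarrow> (('v, 'a) path \<Rightarrow>\<^sub>0 'k::field) \<Rightarrow> (('v, 'a) path \<Rightarrow>\<^sub>0 'k)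
     \<Rightarrow> (('v, 'a) path \<Rightarrow>\<^sub>0 'k)"
where
  "path_mult Q f g = (\<Sum>p\<in>Poly_Mapping.keys f. \<Sum>q\<in>Poly_Mapping.keys g.
     if path_end Q p = fst q
     then Poly_Mapping.single (fst p, snd p @ snd q) (Poly_Mapping.lookup f p * Poly_Mapping.lookup g q)
     else 0)"

definition path_algebra ::
  "('v, 'a) pre_digraph \<Rightarrow> ('k::field, ('v, 'a) path \<Rightarrow>\<^sub>0 'k) module"
where
  "path_algebra Q =
     \<lparr>carrier = {f. Poly_Mapping.keys f \<subseteq> paths Q},
      mult = path_mult Q,
      one = (\<Sum>v\<in>verts Q. Poly_Mapping.single (v, []) 1),
      zero = 0,
      add = (+),
      smult = (\<lambda>c f. Poly_Mapping.map ((*) c) f)\<rparr>"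

abbreviation path_elt :: "('v, 'a) path \<Rightarrow> (('v, 'a) path \<Rightarrow>\<^sub>0 'k::field)" where
  "path_elt p \<equiv> Poly_Mapping.single p 1"

abbreviation arrow_elt :: "('v, 'a) pre_digraph \<Rightarrow> 'a \<Rightarrow> (('v, 'a) path \<Rightarrow>\<^sub>0 'k::field)" where
  "arrow_elt Q a \<equiv> path_elt (tail Q a, [a])"


section \<open>Quotient algebras and isomorphism of algebras\<close>

text \<open>
  \<^const>\<open>FactRing\<close> forgets the scalar multiplication; it is put back here. An ideal of a unital
  algebra is a subspace, so each of the unions below is a single coset.
\<close>

definition quotient_algebra ::
  "('k, 'b, 'm) module_scheme \<Rightarrow> 'b set \<Rightarrow> ('k, 'b set) module"
where
  "quotient_algebra A I =
     ring.extend (A Quot I) (module.fields (\<lambda>c X. \<Union>x\<in>X. I +>\<^bsub>A\<^esub> (c \<odot>\<^bsub>A\<^esub> x)))"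

definition algebra_iso ::
  "('k, 'b, 'm) module_scheme \<Rightarrow> ('k, 'c, 'n) module_scheme \<Rightarrow> bool"
where
  "algebra_iso A B \<longleftrightarrow>
     (\<exists>h\<in>ring_iso A B. \<forall>c. \<forall>x\<in>carrier A. h (c \<odot>\<^bsub>A\<^esub> x) = c \<odot>\<^bsub>B\<^esub> h x)"

definition indecomposable_algebra :: "('b, 'm) ring_scheme \<Rightarrow> bool" where
  "indecomposable_algebra A \<longleftrightarrow>
     carrier A \<noteq> {\<zero>\<^bsub>A\<^esub>} \<and>
     \<not> (\<exists>J L. ideal J A \<and> ideal L A \<and> J \<noteq> {\<zero>\<^bsub>A\<^esub>} \<and> L \<noteq> {\<zero>\<^bsub>A\<^esub>} \<and>
            J \<inter> L = {\<zero>\<^bsub>A\<^esub>} \<and> J <+>\<^bsub>A\<^esub> L = carrier A)"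


section \<open>Almost gentle presentations\<close>

definition arrow_ideal :: "('v, 'a) pre_digraph \<Rightarrow> (('v, 'a) path \<Rightarrow>\<^sub>0 'k::field) set" where
  "arrow_ideal Q = Idl\<^bsub>path_algebra Q\<^esub> (arrow_elt Q ` arcs Q)"

primrec arrow_ideal_power ::
  "('v, 'a) pre_digraph \<Rightarrow> nat \<Rightarrow> (('v, 'a) path \<Rightarrow>\<^sub>0 'k::field) set"
where
  "arrow_ideal_power Q 0 = carrier (path_algebra Q)"
| "arrow_ideal_power Q (Suc n) = arrow_ideal_power Q n \<cdot>\<^bsub>path_algebra Q\<^esub> arrow_ideal Q"

definition admissible_ideal ::
  "('v, 'a) pre_digraph \<Rightarrow> (('v, 'a) path \<Rightarrow>\<^sub>0 'k::field) set \<Rightarrow> bool"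
where
  "admissible_ideal Q I \<longleftrightarrow>
     ideal I (path_algebra Q) \<and>
     (\<exists>n\<ge>2. arrow_ideal_power Q n \<subseteq> I) \<and> I \<subseteq> arrow_ideal_power Q 2"

definition almost_gentle_S0 ::
  "('v, 'a) pre_digraph \<Rightarrow> (('v, 'a) path \<Rightarrow>\<^sub>0 'k::field) set \<Rightarrow> bool"
where
  "almost_gentle_S0 Q I \<longleftrightarrow>
     (\<exists>\<rho>. \<rho> \<subseteq> {p \<in> paths Q. length (snd p) = 2} \<and> I = Idl\<^bsub>path_algebra Q\<^esub> (path_elt ` \<rho>))"

definition almost_gentle_S1 ::
  "('v, 'a) pre_digraph \<Rightarrow> (('v, 'a) path \<Rightarrow>\<^sub>0 'k::field) set \<Rightarrow> bool"
where
  "almost_gentle_S1 Q I \<longleftrightarrow>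
     (\<forall>a\<in>arcs Q.
        (\<exists>\<^sub>\<le>\<^sub>1b. b \<in> arcs Q \<and> arrow_elt Q a \<otimes>\<^bsub>path_algebra Q\<^esub> arrow_elt Q b \<notin> I) \<and>
        (\<exists>\<^sub>\<le>\<^sub>1c. c \<in> arcs Q \<and> arrow_elt Q c \<otimes>\<^bsub>path_algebra Q\<^esub> arrow_elt Q a \<notin> I))"

definition almost_gentle ::
  "('v, 'a) pre_digraph \<Rightarrow> (('v, 'a) path \<Rightarrow>\<^sub>0 'k::field) set \<Rightarrow> bool"
where
  "almost_gentle Q I \<longleftrightarrow> almost_gentle_S0 Q I \<and> almost_gentle_S1 Q I"

text \<open>
  A trivial path is maximal precisely when its vertex is incident with no arrow, which for an
  indecomposable algebra means that the algebra is \<open>K\<close>.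
\<close>

definition maximal_paths ::
  "('v, 'a) pre_digraph \<Rightarrow> (('v, 'a) path \<Rightarrow>\<^sub>0 'k::field) set \<Rightarrow> ('v, 'a) path set"
where
  "maximal_paths Q I =
     {p \<in> paths Q. path_elt p \<notin> I \<and>
        (\<forall>a\<in>arcs Q. arrow_elt Q a \<otimes>\<^bsub>path_algebra Q\<^esub> path_elt p \<in> I \<and>
                   path_elt p \<otimes>\<^bsub>path_algebra Q\<^esub> arrow_elt Q a \<in> I)}"


section \<open>The presentation of the trivial extension\<close>

text \<open>
  The arrows of the quiver of \<open>T(A)\<close> are \<open>Inl a\<close> for the arrows \<open>a\<close> of \<open>Q\<close> and
  \<open>Inr m\<close> for the new arrows \<open>\<beta>\<^sub>m\<close>.
\<close>

type_synonym ('v, 'a) trivext_arrow = "'a + ('v, 'a) path"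

definition new_arrows ::
  "('v, 'a) pre_digraph \<Rightarrow> (('v, 'a) path \<Rightarrow>\<^sub>0 'k::field) set \<Rightarrow> ('v, 'a) trivext_arrow set"
where
  "new_arrows Q I = Inr ` maximal_paths Q I"

definition trivext_quiver ::
  "('v, 'a) pre_digraph \<Rightarrow> (('v, 'a) path \<Rightarrow>\<^sub>0 'k::field) set
     \<Rightarrow> ('v, ('v, 'a) trivext_arrow) pre_digraph"
where
  "trivext_quiver Q I =
     \<lparr>verts = verts Q,
      arcs = Inl ` arcs Q \<union> new_arrows Q I,
      tail = case_sum (tail Q) (path_end Q),
      head = case_sum (head Q) fst\<rparr>"

text \<open>The arrows of the cycle \<open>m \<beta>\<^sub>m\<close>.\<close>

definition cycle_of :: "('v, 'a) path \<Rightarrow> ('v, 'a) trivext_arrow list" where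
  "cycle_of m = map Inl (snd m) @ [Inr m]"

definition special_cycles ::
  "('v, 'a) pre_digraph \<Rightarrow> (('v, 'a) path \<Rightarrow>\<^sub>0 'k::field) set
     \<Rightarrow> ('v, ('v, 'a) trivext_arrow) path set"
where
  "special_cycles Q I =
     {(tail (trivext_quiver Q I) (hd c), c) | c.
        \<exists>m\<in>maximal_paths Q I. \<exists>n. c = rotate n (cycle_of m)}"

definition trivext_relations ::
  "('v, 'a) pre_digraph \<Rightarrow> (('v, 'a) path \<Rightarrow>\<^sub>0 'k::field) set
     \<Rightarrow> (('v, ('v, 'a) trivext_arrow) path \<Rightarrow>\<^sub>0 'k) set"
where
  "trivext_relations Q I = (let T = trivext_quiver Q I in
     {path_elt C - path_elt C' | C C'.
        C \<in> special_cycles Q I \<and> C' \<in> special_cycles Q I \<and> fst C = fst C'} \<union>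
     {path_elt C \<otimes>\<^bsub>path_algebra T\<^esub> arrow_elt T (hd (snd C)) | C. C \<in> special_cycles Q I} \<union>
     {arrow_elt T a \<otimes>\<^bsub>path_algebra T\<^esub> arrow_elt T b | a b.
        a \<in> arcs T \<and> b \<in> arcs T \<and> \<not> (\<exists>C\<in>special_cycles Q I. sublist [a, b] (snd C))})"

definition trivext_ideal ::
  "('v, 'a) pre_digraph \<Rightarrow> (('v, 'a) path \<Rightarrow>\<^sub>0 'k::field) set
     \<Rightarrow> (('v, ('v, 'a) trivext_arrow) path \<Rightarrow>\<^sub>0 'k) set"
where
  "trivext_ideal Q I = Idl\<^bsub>path_algebra (trivext_quiver Q I)\<^esub> (trivext_relations Q I)"


section \<open>Admissible cuts\<close>

text \<open>
  \<open>R\<close> is a choice \<open>C\<^sub>1, \<dots>, C\<^sub>t\<close> of representatives of the special cycles up to cyclic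
  permutation.
\<close>

definition cycle_representatives ::
  "('v, 'a) pre_digraph \<Rightarrow> (('v, 'a) path \<Rightarrow>\<^sub>0 'k::field) set
     \<Rightarrow> ('v, ('v, 'a) trivext_arrow) path set \<Rightarrow> bool"
where
  "cycle_representatives Q I R \<longleftrightarrow>
     R \<subseteq> special_cycles Q I \<and>
     (\<forall>C\<in>special_cycles Q I. \<exists>!C'. C' \<in> R \<and> (\<exists>n. snd C' = rotate n (snd C)))"

definition admissible_cut ::
  "('v, 'a) pre_digraph \<Rightarrow> (('v, 'a) path \<Rightarrow>\<^sub>0 'k::field) set
     \<Rightarrow> ('v, ('v, 'a) trivext_arrow) path set \<Rightarrow> ('v, 'a) trivext_arrow set \<Rightarrow> bool"
where
  "admissible_cut Q I R X \<longleftrightarrow>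
     X \<subseteq> arcs (trivext_quiver Q I) \<and>
     X \<subseteq> (\<Union>C\<in>R. set (snd C)) \<and>
     (\<forall>C\<in>R. \<exists>!a. a \<in> X \<and> a \<in> set (snd C))"

definition cut_algebra ::
  "('v, 'a) pre_digraph \<Rightarrow> (('v, 'a) path \<Rightarrow>\<^sub>0 'k::field) set \<Rightarrow> ('v, 'a) trivext_arrow set
     \<Rightarrow> ('k, (('v, ('v, 'a) trivext_arrow) path \<Rightarrow>\<^sub>0 'k) set) module"
where
  "cut_algebra Q I X = (let T = trivext_quiver Q I in
     quotient_algebra (path_algebra T)
       (Idl\<^bsub>path_algebra T\<^esub> (trivext_ideal Q I \<union> arrow_elt T ` X)))"

end

theory Submission
  imports Defs
begin

text \<open>
  Forgetting the new arrows, that is, sending every path through some \<open>\<beta>\<^sub>m\<close> to \<open>0\<close>, is a surjective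
  algebra homomorphism \<open>\<pi> : K Q\<^sub>T \<rightarrow> K Q\<close> whose kernel is \<open>\<langle>D\<rangle>\<close>. It therefore suffices that \<open>\<pi>\<close> maps
  \<open>\<langle>I\<^sub>T \<union> D\<rangle>\<close> onto \<open>I\<close>. Every special cycle contains a new arrow, so only the relations \<open>ab\<close> with old
  arrows \<open>a\<close>, \<open>b\<close> survive. If \<open>ab\<close> is a path outside \<open>I\<close>, it extends to a maximal path, because
  nonzero paths have bounded length, and hence is a subpath of a special cycle. If \<open>ab \<in> I\<close>, it is
  not a subpath of any special cycle \<open>C\<close>: the arrows before and after the only new arrow of \<open>C\<close> form
  subpaths of a maximal path, which is not in \<open>I\<close>.
\<close>

section \<open>Finitely supported functions\<close>

text \<open>Reduces linear statements to monomials while keeping every support inside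
  \<open>P\<close>, so that \<open>P\<close> can be the set of paths of a quiver or the paths
  through a new arrow.\<close>

lemma poly_mapping_monomial_induct [consumes 1, case_names zero single add]:
  fixes f :: "'p \<Rightarrow>\<^sub>0 'k::comm_monoid_add"
  assumes "Poly_Mapping.keys f \<subseteq> P"
    and "Q 0"
    and "\<And>p c. p \<in> P \<Longrightarrow> Q (Poly_Mapping.single p c)"
    and add: "\<And>f g. \<lbrakk>Poly_Mapping.keys f \<subseteq> P; Poly_Mapping.keys g \<subseteq> P; Q f; Q g\<rbrakk> \<Longrightarrow> Q (f + g)"
  shows "Q f"
  using assms(1)
proof (induction f rule: update_induct)
  case const
  show ?case by (rule assms(2))
next
  case (update f a b)
  \<comment> \<open>The key \<open>a\<close> is fresh, so updating there is the same as adding a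
    monomial.\<close>
  have "Poly_Mapping.update a b f = Poly_Mapping.single a b + f"
    using update(1)
    by (intro poly_mapping_eqI) (auto simp: lookup_update lookup_add lookup_single in_keys_iff)
  moreover have "a \<in> P" "Poly_Mapping.keys f \<subseteq> P"
    using update by (auto simp: keys_update)
  ultimately show ?case
    using update(3) assms(3)[of a b] by (simp add: add)
qed

lemma keys_add_subset:
  assumes "Poly_Mapping.keys f \<subseteq> P" "Poly_Mapping.keys g \<subseteq> P"
  shows "Poly_Mapping.keys (f + g) \<subseteq> P"
  using keys_add Un_least[OF assms] by (rule order_trans)

lemma lookup_map_scale:
  fixes c :: "'k::semiring_0"
  shows "Poly_Mapping.lookup (Poly_Mapping.map ((*) c) f) p = c * Poly_Mapping.lookup f p"
  by (simp add: Poly_Mapping.map.rep_eq when_def)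

lemma map_scale_zero: "Poly_Mapping.map ((*) c) 0 = (0 :: 'p \<Rightarrow>\<^sub>0 'k::semiring_0)"
  by (rule poly_mapping_eqI) (simp add: lookup_map_scale)

lemma map_scale_add:
  fixes c :: "'k::semiring_0"
  shows "Poly_Mapping.map ((*) c) (f + g) = Poly_Mapping.map ((*) c) f + Poly_Mapping.map ((*) c) g"
  by (rule poly_mapping_eqI) (simp add: lookup_map_scale lookup_add distrib_left)

lemma keys_map_scale:
  fixes c :: "'k::semiring_0"
  shows "Poly_Mapping.keys (Poly_Mapping.map ((*) c) f) \<subseteq> Poly_Mapping.keys f"
  by (auto simp: in_keys_iff lookup_map_scale)

text \<open>\<open>map_key f\<close> reads coefficients only at keys \<open>f x\<close>, hence loses
  every monomial off the range.\<close>

lemma map_key_single_notin_range: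
  assumes "inj f" "k \<notin> range f"
  shows "Poly_Mapping.map_key f (Poly_Mapping.single k v) = 0"
  using assms by (intro poly_mapping_eqI) (auto simp: map_key.rep_eq lookup_single when_def)

lemma map_key_sum:
  assumes "inj f"
  shows "Poly_Mapping.map_key f (sum g S) = (\<Sum>s\<in>S. Poly_Mapping.map_key f (g s))"
  by (induction S rule: infinite_finite_induct)
    (simp_all add: map_key_plus[OF assms] map_key_zero[OF assms])

section \<open>The path algebra is a ring\<close>

lemma path_end_conv: "path_end Q (u, as) = (if as = [] then u else head Q (last as))"
  by (simp add: path_end_def pre_digraph.awalk_verts_conv)

lemma path_end_append: "path_end Q (u, as @ bs) = path_end Q (path_end Q (u, as), bs)"
  by (simp add: path_end_conv)

lemma paths_Nil: "(u, []) \<in> paths Q \<longleftrightarrow> u \<in> verts Q"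
  by (simp add: paths_def path_end_conv pre_digraph.awalk_def pre_digraph.cas.simps)

lemma paths_append:
  assumes "wf_digraph Q"
  shows "(u, as @ bs) \<in> paths Q \<longleftrightarrow>
    (u, as) \<in> paths Q \<and> (path_end Q (u, as), bs) \<in> paths Q"
  using wf_digraph.awalk_append_iff[OF assms, of u as bs "path_end Q (u, as @ bs)"]
  by (simp add: paths_def path_end_append[of Q u as bs]) (simp add: path_end_def)

lemma paths_single:
  assumes "wf_digraph Q"
  shows "(u, [a]) \<in> paths Q \<longleftrightarrow> a \<in> arcs Q \<and> tail Q a = u"
  using wf_digraph.tail_in_verts[OF assms]
  by (auto simp: paths_def path_end_conv pre_digraph.awalk_def pre_digraph.cas.simps)

lemma path_end_in_verts:
  assumes "wf_digraph Q" "p \<in> paths Q"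
  shows "path_end Q p \<in> verts Q"
  using assms wf_digraph.awalk_last_in_verts by (fastforce simp: paths_def)

lemma path_start_in_verts: "p \<in> paths Q \<Longrightarrow> fst p \<in> verts Q"
  by (simp add: paths_def pre_digraph.awalk_def)

lemma set_path_subset: "p \<in> paths Q \<Longrightarrow> set (snd p) \<subseteq> arcs Q"
  by (simp add: paths_def pre_digraph.awalk_def)

lemma paths_tail_hd: "p \<in> paths Q \<Longrightarrow> snd p \<noteq> [] \<Longrightarrow> tail Q (hd (snd p)) = fst p"
  by (simp add: paths_def pre_digraph.awalk_def pre_digraph.cas_simp)

section \<open>Bilinear extension of concatenation\<close>

lemma path_mult_single:
  "path_mult Q (Poly_Mapping.single p a) (Poly_Mapping.single q b) =
     (if path_end Q p = fst q then Poly_Mapping.single (fst p, snd p @ snd q) (a * b) else 0)"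
  \<comment> \<open>A monomial with coefficient 0 has empty support, so the defining sums are empty
    in those cases.\<close>
  by (cases "a = 0"; cases "b = 0") (simp_all add: path_mult_def)

lemma path_mult_zero [simp]: "path_mult Q 0 f = 0" "path_mult Q f 0 = 0"
  by (simp_all add: path_mult_def)

text \<open>Cancellation may shrink the support of \<open>f + g\<close>; this is harmless because
  the summand is additive in the coefficient and vanishes at coefficient 0.\<close>

lemma path_mult_add_left: "path_mult Q (f + g) h = path_mult Q f h + path_mult Q g h"
  unfolding path_mult_def
  by (rule setsum_keys_plus_distrib[where f = "\<lambda>p x. \<Sum>q\<in>Poly_Mapping.keys h.
        if path_end Q p = fst q
        then Poly_Mapping.single (fst p, snd p @ snd q) (x * Poly_Mapping.lookup h q) else 0"])
    (auto simp: single_add distrib_right simp flip: sum.distrib intro!: sum.neutral sum.cong)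

lemma path_mult_add_right: "path_mult Q f (g + h) = path_mult Q f g + path_mult Q f h"
  unfolding path_mult_def sum.distrib[symmetric]
  by (rule sum.cong[OF refl],
      rule setsum_keys_plus_distrib[where f = "\<lambda>q x.
        if path_end Q _ = fst q
        then Poly_Mapping.single (fst _, snd _ @ snd q) (Poly_Mapping.lookup f _ * x) else 0"])
    (auto simp: single_add distrib_left)

text \<open>By trilinearity only three monomials matter. There it is associativity of list
  concatenation, and \<open>path_end_append\<close> makes the composability conditions on both sides
  agree.\<close>

lemma path_mult_assoc: "path_mult Q (path_mult Q f g) h = path_mult Q f (path_mult Q g h)"
proof (induction f rule: poly_mapping_monomial_induct[OF subset_UNIV, case_names zero f_single add])
  case (f_single p a)
  show ?case
  proof (induction g rule: poly_mapping_monomial_induct[OF subset_UNIV, case_names zero g_single add])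
    case (g_single q b)
    show ?case
      by (induction h rule: poly_mapping_monomial_induct[OF subset_UNIV])
        (auto simp: path_mult_single path_mult_add_right path_end_append mult.assoc)
  qed (simp_all add: path_mult_add_left path_mult_add_right)
qed (simp_all add: path_mult_add_left)

lemma scale_path_mult:
  "Poly_Mapping.map ((*) c) (path_mult Q f g) = path_mult Q (Poly_Mapping.map ((*) c) f) g"
proof (induction f rule: poly_mapping_monomial_induct[OF subset_UNIV, case_names zero f_single add])
  case (f_single p a)
  show ?case
    by (induction g rule: poly_mapping_monomial_induct[OF subset_UNIV])
      (auto simp: path_mult_single path_mult_add_right map_scale_add map_scale_zero mult.assoc)
qed (simp_all add: path_mult_add_left map_scale_add map_scale_zero)

lemma path_algebra_simps [simp]:
  "carrier (path_algebra Q) = {f. Poly_Mapping.keys f \<subseteq> paths Q}"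
  "mult (path_algebra Q) = path_mult Q"
  "one (path_algebra Q) = (\<Sum>v\<in>verts Q. Poly_Mapping.single (v, []) 1)"
  "zero (path_algebra Q) = 0"
  "add (path_algebra Q) = (+)"
  "smult (path_algebra Q) = (\<lambda>c f. Poly_Mapping.map ((*) c) f)"
  by (simp_all add: path_algebra_def)

lemma path_mult_closed:
  assumes "wf_digraph Q"
    and "Poly_Mapping.keys f \<subseteq> paths Q" "Poly_Mapping.keys g \<subseteq> paths Q"
  shows "Poly_Mapping.keys (path_mult Q f g) \<subseteq> paths Q"
  using assms(2)
proof (induction f rule: poly_mapping_monomial_induct)
  case (single p a)
  from assms(3) show ?case
  proof (induction g rule: poly_mapping_monomial_induct)
    case (single q b)
    show ?case
      using \<open>p \<in> paths Q\<close> \<open>q \<in> paths Q\<close> paths_append[OF assms(1), of "fst p" "snd p" "snd q"]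
      by (simp add: path_mult_single)
  next
    case (add f g)
    then show ?case
      unfolding path_mult_add_right by (intro keys_add_subset add.IH)
  qed simp
next
  case (add f h)
  then show ?case
    unfolding path_mult_add_left by (intro keys_add_subset add.IH)
qed simp

text \<open>Among the trivial paths summed to the identity, exactly the one at the start vertex of a
  given path composes with it.\<close>

lemma path_mult_one_left:
  assumes "finite (verts Q)" "Poly_Mapping.keys f \<subseteq> paths Q"
  shows "path_mult Q (\<Sum>v\<in>verts Q. Poly_Mapping.single (v, []) 1) f = f"
  using assms(2)
proof (induction f rule: poly_mapping_monomial_induct)
  case (single p a)
  have sum: "path_mult Q (sum e V) g = (\<Sum>v\<in>V. path_mult Q (e v) g)" for e V and g :: "('a, 'b) path \<Rightarrow>\<^sub>0 'c"
    by (induction V rule: infinite_finite_induct) (simp_all add: path_mult_add_left)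
  have "fst p \<in> verts Q" by (rule path_start_in_verts) fact
  then show ?case
    using assms(1) by (simp add: sum path_mult_single path_end_conv if_distrib cong: if_cong)
qed (simp_all add: path_mult_add_right)

lemma path_mult_one_right:
  assumes "wf_digraph Q" "finite (verts Q)" "Poly_Mapping.keys f \<subseteq> paths Q"
  shows "path_mult Q f (\<Sum>v\<in>verts Q. Poly_Mapping.single (v, []) 1) = f"
  using assms(3)
proof (induction f rule: poly_mapping_monomial_induct)
  case (single p a)
  have sum: "path_mult Q g (sum e V) = (\<Sum>v\<in>V. path_mult Q g (e v))" for e V and g :: "('a, 'b) path \<Rightarrow>\<^sub>0 'c"
    by (induction V rule: infinite_finite_induct) (simp_all add: path_mult_add_right)
  have "path_end Q p \<in> verts Q" by (rule path_end_in_verts) fact+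
  then show ?case
    using assms(2) by (simp add: sum path_mult_single if_distrib cong: if_cong)
qed (simp_all add: path_mult_add_left)

lemma ring_path_algebra:
  assumes "wf_digraph Q" "finite (verts Q)"
  shows "ring (path_algebra Q :: ('k::field, ('v, 'a) path \<Rightarrow>\<^sub>0 'k) module)"
proof (rule ringI)
  let ?A = "path_algebra Q :: ('k, ('v, 'a) path \<Rightarrow>\<^sub>0 'k) module"
  show "abelian_group ?A"
  proof (rule abelian_groupI)
    fix f assume "f \<in> carrier ?A"
    then show "\<exists>g\<in>carrier ?A. g \<oplus>\<^bsub>?A\<^esub> f = \<zero>\<^bsub>?A\<^esub>"
      by (intro bexI[of _ "- f"]) simp_all
  next
    fix f g assume "f \<in> carrier ?A" "g \<in> carrier ?A"
    then show "f \<oplus>\<^bsub>?A\<^esub> g \<in> carrier ?A"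
      using keys_add[of f g] by auto
  qed (auto simp: ac_simps)
  show "Group.monoid ?A"
  proof (rule monoidI)
    \<comment> \<open>Generalized to subsets of the vertex set, so that induction on finite sets
      applies.\<close>
    have "Poly_Mapping.keys (\<Sum>v\<in>V. Poly_Mapping.single (v, []) (1::'k)) \<subseteq> paths Q"
      if "V \<subseteq> verts Q" for V
      using finite_subset[OF that assms(2)] that
    proof (induction V rule: finite_induct)
      case (insert v V)
      have "(v, []) \<in> paths Q" using insert.prems by (simp add: paths_Nil)
      with insert show ?case
        using keys_add[of "Poly_Mapping.single (v, []) (1::'k)"] by fastforce
    qed simp
    then show "\<one>\<^bsub>?A\<^esub> \<in> carrier ?A" by simp
  qed (simp_all add: path_mult_closed path_mult_assoc path_mult_one_left path_mult_one_right assms)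
qed (simp_all add: path_mult_add_left path_mult_add_right)

section \<open>Ideals of the path algebra\<close>

lemma smult_closed_ideal:
  assumes "wf_digraph Q" "finite (verts Q)" "ideal I (path_algebra Q)" "f \<in> I"
  shows "Poly_Mapping.map ((*) c) f \<in> I"
proof -
  interpret I: ideal I "path_algebra Q" by fact
  have "f \<in> carrier (path_algebra Q)" using I.Icarr assms(4) .
  \<comment> \<open>Scaling by \<open>c\<close> is left multiplication by the ring element
    \<open>c\<close> times 1.\<close>
  then have "Poly_Mapping.map ((*) c) f = path_mult Q (Poly_Mapping.map ((*) c) \<one>\<^bsub>path_algebra Q\<^esub>) f"
    using path_mult_one_left[OF assms(2), of f] by (simp flip: scale_path_mult)
  also have "\<dots> \<in> I"
    using I.I_l_closed[OF assms(4), of "Poly_Mapping.map ((*) c) \<one>\<^bsub>path_algebra Q\<^esub>"]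
      I.one_closed keys_map_scale by fastforce
  finally show ?thesis .
qed

text \<open>Multiply by the prefix on the left and by the suffix on the right. As a path records its
  start vertex, the vertex where the inner path begins must be matched explicitly.\<close>

lemma ideal_superpath:
  assumes "wf_digraph Q" "ideal I (path_algebra Q)"
    and "path_elt (v, bs) \<in> I" "(u, as @ bs @ cs) \<in> paths Q" "path_end Q (u, as) = v"
  shows "path_elt (u, as @ bs @ cs) \<in> I"
proof -
  interpret I: ideal I "path_algebra Q" by fact
  let ?w = "path_end Q (v, bs)"
  have paths: "(u, as) \<in> paths Q" "(?w, cs) \<in> paths Q"
    using assms(4,5) by (simp_all add: paths_append[OF assms(1)] path_end_append)
  have "path_mult Q (path_elt (u, as)) (path_elt (v, bs)) \<in> I"
    using I.I_l_closed[OF assms(3)] paths by simp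
  then have "path_mult Q (path_mult Q (path_elt (u, as)) (path_elt (v, bs))) (path_elt (?w, cs)) \<in> I"
    using I.I_r_closed paths by simp
  then show ?thesis
    using assms(5) by (simp add: path_mult_single path_end_append)
qed


section \<open>Isomorphisms of quotient algebras\<close>

text \<open>Surjectivity gives the absorption property: each multiplier from \<open>S\<close> is the
  image of one from \<open>R\<close>.\<close>

lemma ring_hom_ring_image_ideal:
  assumes "ring_hom_ring R S h" "h ` carrier R = carrier S" "ideal J R"
  shows "ideal (h ` J) S"
proof -
  interpret h: ring_hom_ring R S h by fact
  interpret J: ideal J R by fact
  show ?thesis
  proof (rule idealI)
    show "ring S" by unfold_locales
    show "subgroup (h ` J) (add_monoid S)"
    proof (rule group.subgroupI)
      show "Group.group (add_monoid S)" by (rule h.S.add.is_group)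
      show "h ` J \<subseteq> carrier (add_monoid S)" using J.a_subset by auto
      show "h ` J \<noteq> {}" using additive_subgroup.zero_closed[OF J.is_additive_subgroup] by blast
      fix y assume "y \<in> h ` J"
      then obtain x where x: "x \<in> J" "y = h x" by auto
      then have "inv\<^bsub>add_monoid S\<^esub> y = h (\<ominus>\<^bsub>R\<^esub> x)"
        using J.Icarr by (simp flip: a_inv_def)
      then show "inv\<^bsub>add_monoid S\<^esub> y \<in> h ` J" using x(1) by (metis J.a_inv_closed imageI)
      fix z assume "z \<in> h ` J"
      then obtain x' where x': "x' \<in> J" "z = h x'" by auto
      have eq: "y \<oplus>\<^bsub>S\<^esub> z = h (x \<oplus>\<^bsub>R\<^esub> x')" using x x' J.Icarr by simp
      have "y \<oplus>\<^bsub>S\<^esub> z \<in> h ` J" unfolding eq by (intro imageI J.a_closed x x')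
      then show "y \<otimes>\<^bsub>add_monoid S\<^esub> z \<in> h ` J" by simp
    qed
    fix a s assume "a \<in> h ` J" "s \<in> carrier S"
    then obtain x r where x: "x \<in> J" "a = h x" and r: "r \<in> carrier R" "s = h r"
      using assms(2) by (metis imageE)
    have eq: "s \<otimes>\<^bsub>S\<^esub> a = h (r \<otimes>\<^bsub>R\<^esub> x)" "a \<otimes>\<^bsub>S\<^esub> s = h (x \<otimes>\<^bsub>R\<^esub> r)"
      using x r J.Icarr by simp_all
    show "s \<otimes>\<^bsub>S\<^esub> a \<in> h ` J"
      unfolding eq by (rule imageI) (rule J.I_l_closed[OF x(1) r(1)])
    show "a \<otimes>\<^bsub>S\<^esub> s \<in> h ` J"
      unfolding eq by (rule imageI) (rule J.I_r_closed[OF x(1) r(1)])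
  qed
qed

text \<open>Composing \<open>h\<close> with the projection of \<open>S\<close> onto its quotient
  presents the preimage of \<open>I\<close> as a kernel. This yields both that it is an ideal and,
  for surjective \<open>h\<close>, the isomorphism of quotients.\<close>

lemma ring_hom_ring_rcos:
  assumes "ring_hom_ring R S h" "ideal I S"
  shows "ring_hom_ring R (S Quot I) (\<lambda>x. I +>\<^bsub>S\<^esub> h x)"
    and "a_kernel R (S Quot I) (\<lambda>x. I +>\<^bsub>S\<^esub> h x) = {x \<in> carrier R. h x \<in> I}"
proof -
  interpret h: ring_hom_ring R S h by fact
  interpret I: ideal I S by fact
  show "ring_hom_ring R (S Quot I) (\<lambda>x. I +>\<^bsub>S\<^esub> h x)"
    by (rule ring_hom_ringI2[OF h.R.ring_axioms I.quotient_is_ring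
          ring_hom_trans[OF h.homh I.rcos_ring_hom, unfolded comp_def]])
  have "I +>\<^bsub>S\<^esub> h x = I \<longleftrightarrow> h x \<in> I" if "x \<in> carrier R" for x
    using I.a_rcos_const[of "h x"] I.rcos_const_imp_mem[of "h x"] h.hom_closed[OF that] by blast
  then show "a_kernel R (S Quot I) (\<lambda>x. I +>\<^bsub>S\<^esub> h x) = {x \<in> carrier R. h x \<in> I}"
    unfolding a_kernel_def' FactRing_def by auto
qed

lemma ring_hom_ring_preimage_ideal:
  assumes "ring_hom_ring R S h" "ideal I S"
  shows "ideal {x \<in> carrier R. h x \<in> I} R"
  using ring_hom_ring.kernel_is_ideal[OF ring_hom_ring_rcos(1)[OF assms]]
  by (simp only: ring_hom_ring_rcos(2)[OF assms])

lemma quotient_algebra_simps [simp]: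
  "carrier (quotient_algebra A I) = carrier (A Quot I)"
  "mult (quotient_algebra A I) = mult (A Quot I)"
  "one (quotient_algebra A I) = one (A Quot I)"
  "add (quotient_algebra A I) = add (A Quot I)"
  "smult (quotient_algebra A I) = (\<lambda>c X. \<Union>x\<in>X. I +>\<^bsub>A\<^esub> (c \<odot>\<^bsub>A\<^esub> x))"
  by (simp_all add: quotient_algebra_def ring.defs module.defs)

text \<open>The first isomorphism theorem, applied to \<open>R\<close> mapping through
  \<open>S\<close> to the quotient by \<open>I\<close>, settles the ring structure. The rest of the
  proof treats scalars, whose action on a quotient is a union of cosets that must be shown to be a
  single coset.\<close>

lemma quotient_algebra_iso_preimage:
  fixes R :: "('k, 'b, 'm) module_scheme" and S :: "('k, 'c, 'n) module_scheme"
  assumes "ring_hom_ring R S h" "h ` carrier R = carrier S" "ideal I S"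
    and R_smult: "\<And>c x. x \<in> carrier R \<Longrightarrow> c \<odot>\<^bsub>R\<^esub> x \<in> carrier R"
    and S_smult: "\<And>c x. x \<in> carrier S \<Longrightarrow> c \<odot>\<^bsub>S\<^esub> x \<in> carrier S"
    and S_smult_add: "\<And>c x y. \<lbrakk>x \<in> carrier S; y \<in> carrier S\<rbrakk>
      \<Longrightarrow> c \<odot>\<^bsub>S\<^esub> (x \<oplus>\<^bsub>S\<^esub> y) = c \<odot>\<^bsub>S\<^esub> x \<oplus>\<^bsub>S\<^esub> c \<odot>\<^bsub>S\<^esub> y"
    and I_smult: "\<And>c x. x \<in> I \<Longrightarrow> c \<odot>\<^bsub>S\<^esub> x \<in> I"
    and h_smult: "\<And>c x. x \<in> carrier R \<Longrightarrow> h (c \<odot>\<^bsub>R\<^esub> x) = c \<odot>\<^bsub>S\<^esub> h x"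
  shows "algebra_iso (quotient_algebra R {x \<in> carrier R. h x \<in> I}) (quotient_algebra S I)"
proof -
  interpret h: ring_hom_ring R S h by fact
  interpret I: ideal I S by fact
  define g where "g = (\<lambda>x. I +>\<^bsub>S\<^esub> h x)"
  define J where "J = {x \<in> carrier R. h x \<in> I}"
  have g: "ring_hom_ring R (S Quot I) g" and J: "a_kernel R (S Quot I) g = J"
    unfolding g_def J_def using assms(1,3) by (rule ring_hom_ring_rcos)+
  have surj: "g ` carrier R = carrier (S Quot I)"
  proof -
    have "carrier (S Quot I) = (\<lambda>y. I +>\<^bsub>S\<^esub> y) ` carrier S"
      by (auto simp: FactRing_def A_RCOSETS_defs a_r_coset_def)
    then show ?thesis
      by (simp only: assms(2)[symmetric] image_image g_def)
  qed
  \<comment> \<open>\<open>g\<close> is constant on each coset of its kernel \<open>J\<close>, so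
    the image of a coset is a singleton and \<open>the_elem\<close> extracts the value.\<close>
  let ?H = "\<lambda>X. the_elem (g ` X)"
  have iso: "?H \<in> ring_iso (R Quot J) (S Quot I)"
    using ring_hom_ring.FactRing_iso_set[OF g surj] by (simp add: J)
  \<comment> \<open>The scalar action is independent of representatives because \<open>I\<close> is
    closed under scalars.\<close>
  have smult_cong: "I +>\<^bsub>S\<^esub> (c \<odot>\<^bsub>S\<^esub> s) = I +>\<^bsub>S\<^esub> (c \<odot>\<^bsub>S\<^esub> t)"
    if "s \<in> I +>\<^bsub>S\<^esub> t" "t \<in> carrier S" for c s t
  proof -
    obtain i where i: "i \<in> I" "s = i \<oplus>\<^bsub>S\<^esub> t" using \<open>s \<in> _\<close> by (auto simp: a_r_coset_def')
    then have "c \<odot>\<^bsub>S\<^esub> s = c \<odot>\<^bsub>S\<^esub> i \<oplus>\<^bsub>S\<^esub> c \<odot>\<^bsub>S\<^esub> t"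
      using S_smult_add I.Icarr that by simp
    then have "c \<odot>\<^bsub>S\<^esub> s \<in> I +>\<^bsub>S\<^esub> (c \<odot>\<^bsub>S\<^esub> t)"
      using I_smult[OF i(1)] by (auto simp: a_r_coset_def')
    then show ?thesis
      using I.a_repr_independence'[OF _ S_smult[OF that(2)]] by metis
  qed
  have "?H (\<Union>x\<in>X. J +>\<^bsub>R\<^esub> (c \<odot>\<^bsub>R\<^esub> x)) = (\<Union>y\<in>?H X. I +>\<^bsub>S\<^esub> (c \<odot>\<^bsub>S\<^esub> y))"
    if X: "X \<in> carrier (R Quot J)" for c X
  proof -
    obtain x where x: "x \<in> carrier R" "X = J +>\<^bsub>R\<^esub> x"
      using ring_hom_ring.quot_mem[OF g, of X] X by (auto simp: J)
    have hx: "h x \<in> carrier S" using x by simp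
    have HX: "?H X = I +>\<^bsub>S\<^esub> h x"
      using ring_hom_ring.the_elem_simp[OF g x(1), unfolded J] by (simp add: x(2) g_def)
    have x_in: "x \<in> X"
      using ring_hom_ring.homeq_imp_rcos[OF g, of x x] x by (simp add: J)
    \<comment> \<open>All elements of the union of cosets have the same value under
      \<open>g\<close>, whichever representative of \<open>X\<close> they come from.\<close>
    have const: "g y = I +>\<^bsub>S\<^esub> (c \<odot>\<^bsub>S\<^esub> h x)" if y: "y \<in> (\<Union>x\<in>X. J +>\<^bsub>R\<^esub> (c \<odot>\<^bsub>R\<^esub> x))" for y
    proof -
      obtain x' where x': "x' \<in> X" "y \<in> J +>\<^bsub>R\<^esub> (c \<odot>\<^bsub>R\<^esub> x')" using y by auto
      have x'_carr: "x' \<in> carrier R"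
        using x'(1) x by (auto simp: a_r_coset_def' J_def)
      have "g x' = g x" using ring_hom_ring.rcos_imp_homeq[OF g, of x x'] x x' by (simp add: J)
      then have "h x' \<in> I +>\<^bsub>S\<^esub> h x"
        using I.a_rcos_self[of "h x'"] x'_carr by (simp add: g_def)
      moreover have "g y = g (c \<odot>\<^bsub>R\<^esub> x')"
        using ring_hom_ring.rcos_imp_homeq[OF g R_smult[OF x'_carr]] x'(2) by (simp add: J)
      ultimately show ?thesis
        using smult_cong[OF _ hx] by (simp add: g_def h_smult[OF x'_carr])
    qed
    \<comment> \<open>The union is nonempty, so its image under \<open>g\<close> is a singleton and
      not the empty set.\<close>
    have "c \<odot>\<^bsub>R\<^esub> x \<in> J +>\<^bsub>R\<^esub> (c \<odot>\<^bsub>R\<^esub> x)"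
      using ring_hom_ring.homeq_imp_rcos[OF g, of "c \<odot>\<^bsub>R\<^esub> x" "c \<odot>\<^bsub>R\<^esub> x"] R_smult[OF x(1)] by (simp add: J)
    with x_in have "g ` (\<Union>x\<in>X. J +>\<^bsub>R\<^esub> (c \<odot>\<^bsub>R\<^esub> x)) = {I +>\<^bsub>S\<^esub> (c \<odot>\<^bsub>S\<^esub> h x)}"
      using const by blast
    moreover have "(\<Union>y\<in>?H X. I +>\<^bsub>S\<^esub> (c \<odot>\<^bsub>S\<^esub> y)) = I +>\<^bsub>S\<^esub> (c \<odot>\<^bsub>S\<^esub> h x)"
      unfolding HX using smult_cong[OF _ hx] I.a_rcos_self[OF hx] by blast
    ultimately show ?thesis by simp
  qed
  moreover have "?H \<in> ring_iso (quotient_algebra R J) (quotient_algebra S I)"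
    using iso by (simp add: ring_iso_def ring_hom_def)
  ultimately show ?thesis
    unfolding algebra_iso_def J_def[symmetric] by (intro bexI[of _ ?H]) simp_all
qed


section \<open>Maximal paths\<close>

text \<open>Split off the last arrow, following the recursion of \<open>arrow_ideal_power\<close>,
  which multiplies by the arrow ideal on the right. The base case absorbs whatever prefix is
  left.\<close>

lemma long_path_in_arrow_ideal_power:
  assumes "wf_digraph Q" "p \<in> paths Q" "n \<le> length (snd p)"
  shows "(path_elt p :: _ \<Rightarrow>\<^sub>0 'k::field) \<in> arrow_ideal_power Q n"
  using assms(2,3)
proof (induction n arbitrary: p)
  case 0
  then show ?case by simp
next
  case (Suc n)
  obtain u bs where p: "p = (u, bs)" by (cases p)
  with Suc.prems(2) obtain as a where bs: "bs = as @ [a]" by (cases bs rule: rev_cases) auto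
  have as: "(u, as) \<in> paths Q" and a: "a \<in> arcs Q" "tail Q a = path_end Q (u, as)"
    using Suc.prems(1) by (auto simp: p bs paths_append[OF assms(1)] paths_single[OF assms(1)])
  have "(path_elt (u, as) :: _ \<Rightarrow>\<^sub>0 'k) \<in> arrow_ideal_power Q n"
    using Suc.IH[OF as] Suc.prems(2) by (simp add: p bs)
  moreover have "(arrow_elt Q a :: _ \<Rightarrow>\<^sub>0 'k) \<in> arrow_ideal Q"
    using a(1) by (auto simp: arrow_ideal_def genideal_def)
  ultimately have "(path_elt (u, as) :: _ \<Rightarrow>\<^sub>0 'k) \<otimes>\<^bsub>path_algebra Q\<^esub> arrow_elt Q a \<in> arrow_ideal_power Q (Suc n)"
    by (simp only: arrow_ideal_power.simps ideal_prod.prod)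
  then show ?case using a(2) by (simp add: path_mult_single p bs)
qed

text \<open>A nonzero path that is not maximal can be prolonged by an arrow at one end and stay
  nonzero. Admissibility bounds the length of nonzero paths, so this stops.\<close>

lemma nonzero_path_extends_to_maximal_path:
  assumes "wf_digraph Q" "admissible_ideal Q I" "p \<in> paths Q" "path_elt p \<notin> I"
  shows "\<exists>m\<in>maximal_paths Q I. sublist (snd p) (snd m)"
proof -
  have I: "ideal I (path_algebra Q)" using assms(2) by (simp add: admissible_ideal_def)
  have zero: "0 \<in> I"
    using additive_subgroup.zero_closed[OF ideal.axioms(1)[OF I]] by simp
  obtain N where N: "arrow_ideal_power Q N \<subseteq> I" using assms(2) by (auto simp: admissible_ideal_def)
  show ?thesis
    using assms(3,4)
  proof (induction "N - length (snd p)" arbitrary: p rule: less_induct)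
    case less
    \<comment> \<open>Strictness ensures that the truncated difference
      \<open>N - length (snd p)\<close> really drops when an arrow is added.\<close>
    have lt: "length (snd p) < N"
      using long_path_in_arrow_ideal_power[OF assms(1) less.prems(1), of N] N less.prems(2)
      by (meson not_le subsetD)
    show ?case
    proof (cases "p \<in> maximal_paths Q I")
      case False
      then obtain a where a: "a \<in> arcs Q"
        and "path_mult Q (arrow_elt Q a) (path_elt p) \<notin> I \<or> path_mult Q (path_elt p) (arrow_elt Q a) \<notin> I"
        using less.prems by (auto simp: maximal_paths_def)
      \<comment> \<open>A product outside \<open>I\<close> is not 0, so its factors are composable
        and it is a single path.\<close>
      then consider "path_end Q (tail Q a, [a]) = fst p" "path_elt (tail Q a, [a] @ snd p) \<notin> I"
        | "path_end Q p = tail Q a" "path_elt (fst p, snd p @ [a]) \<notin> I"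
        using zero by (auto simp: path_mult_single split: if_splits)
      then obtain q where "q \<in> paths Q" "path_elt q \<notin> I" "sublist (snd p) (snd q)"
        "length (snd q) = Suc (length (snd p))"
      proof cases
        case 1
        show ?thesis
          by (rule that[of "(tail Q a, [a] @ snd p)"])
            (use 1 a less.prems(1) paths_append[OF assms(1), of "tail Q a" "[a]" "snd p"]
              in \<open>auto simp: paths_single[OF assms(1)] sublist_Cons_right\<close>)
      next
        case 2
        show ?thesis
          by (rule that[of "(fst p, snd p @ [a])"])
            (use 2 a less.prems(1) paths_append[OF assms(1), of "fst p" "snd p" "[a]"]
              in \<open>auto simp: paths_single[OF assms(1)] sublist_append\<close>)
      qed
      moreover from this lt have "N - length (snd q) < N - length (snd p)" by simp
      ultimately show ?thesis using less.hyps sublist_order.order_trans by meson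
    qed auto
  qed
qed


section \<open>The quiver of the trivial extension\<close>

lemma trivext_quiver_simps [simp]:
  "verts (trivext_quiver Q I) = verts Q"
  "arcs (trivext_quiver Q I) = Inl ` arcs Q \<union> Inr ` maximal_paths Q I"
  "tail (trivext_quiver Q I) (Inl a) = tail Q a"
  "tail (trivext_quiver Q I) (Inr m) = path_end Q m"
  "head (trivext_quiver Q I) (Inl a) = head Q a"
  "head (trivext_quiver Q I) (Inr m) = fst m"
  by (simp_all add: trivext_quiver_def new_arrows_def)

lemma maximal_paths_subset: "maximal_paths Q I \<subseteq> paths Q"
  by (auto simp: maximal_paths_def)

lemma wf_digraph_trivext_quiver:
  assumes "wf_digraph Q"
  shows "wf_digraph (trivext_quiver Q I)"
proof
  fix a assume "a \<in> arcs (trivext_quiver Q I)"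
  then show "tail (trivext_quiver Q I) a \<in> verts (trivext_quiver Q I)"
    and "head (trivext_quiver Q I) a \<in> verts (trivext_quiver Q I)"
    using wf_digraph.tail_in_verts[OF assms] wf_digraph.head_in_verts[OF assms] maximal_paths_subset
      path_end_in_verts[OF assms] path_start_in_verts by fastforce+
qed

section \<open>The embedding of old paths\<close>

definition old_path :: "('v, 'a) path \<Rightarrow> ('v, ('v, 'a) trivext_arrow) path" where
  "old_path p = (fst p, map Inl (snd p))"

lemma inj_old_path: "inj old_path"
  by (rule injI) (auto simp: old_path_def prod_eq_iff dest: inj_map_eq_map[THEN iffD1, rotated])

text \<open>This splits the path basis into embedded paths and those that \<open>forget_new\<close>
  kills.\<close>

lemma path_notin_range_old_path: "q \<notin> range old_path \<longleftrightarrow> (\<exists>m. Inr m \<in> set (snd q))"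
proof -
  have "q \<in> range old_path" if "\<forall>m. Inr m \<notin> set (snd q)"
  proof -
    have "map (Inl \<circ> projl) (snd q) = map id (snd q)"
      using that by (intro map_cong refl) (metis comp_apply id_apply sum.sel(1) sumE)
    then have "q = old_path (fst q, map projl (snd q))"
      by (simp add: old_path_def)
    then show ?thesis by blast
  qed
  then show ?thesis by (auto simp: old_path_def)
qed

lemma path_end_old_path: "path_end (trivext_quiver Q I) (old_path p) = path_end Q p"
  by (cases p) (simp add: old_path_def path_end_conv last_map)

lemma old_path_in_paths: "old_path p \<in> paths (trivext_quiver Q I) \<longleftrightarrow> p \<in> paths Q"
proof -
  have "pre_digraph.cas (trivext_quiver Q I) u (map Inl as) v = pre_digraph.cas Q u as v" for u as v
    by (induction as arbitrary: u) (simp_all add: pre_digraph.cas.simps)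
  then show ?thesis
    unfolding paths_def mem_Collect_eq path_end_old_path
    by (auto simp: old_path_def pre_digraph.awalk_def)
qed

section \<open>Special cycles as closed paths\<close>

lemma rotate_closed_path:
  assumes "wf_digraph Q" "(u, c) \<in> paths Q" "path_end Q (u, c) = u" "c \<noteq> []"
  shows "(tail Q (hd (rotate n c)), rotate n c) \<in> paths Q \<and>
    path_end Q (tail Q (hd (rotate n c)), rotate n c) = tail Q (hd (rotate n c))"
proof (induction n)
  case 0
  show ?case using paths_tail_hd[OF assms(2)] assms by simp
next
  case (Suc n)
  obtain a as where aas: "rotate n c = a # as" using assms(4) by (cases "rotate n c") auto
  then have "(tail Q a, [a] @ as) \<in> paths Q" "path_end Q (tail Q a, [a] @ as) = tail Q a"
    using Suc by simp_all
  \<comment> \<open>Without its first arrow \<open>a\<close>, the closed path leads from the head of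
    \<open>a\<close> back to its tail, so \<open>a\<close> can be appended at the end.\<close>
  then have as: "a \<in> arcs Q" "(head Q a, as) \<in> paths Q" "path_end Q (head Q a, as) = tail Q a"
    unfolding paths_append[OF assms(1)] path_end_append
    by (simp_all add: paths_single[OF assms(1)] path_end_conv[of Q _ "[a]"])
  then have path: "(head Q a, as @ [a]) \<in> paths Q"
    by (simp add: paths_append[OF assms(1)] paths_single[OF assms(1)])
  moreover have "tail Q (hd (as @ [a])) = head Q a" using paths_tail_hd[OF path] by simp
  ultimately show ?case by (simp add: aas path_end_conv)
qed

text \<open>The new arrow of \<open>m\<close> returns from the end of \<open>m\<close> to its start,
  so \<open>cycle_of m\<close> is a closed path, and closed paths survive rotation.\<close>

lemma special_cycle_in_paths:
  assumes "wf_digraph Q" "C \<in> special_cycles Q I"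
  shows "C \<in> paths (trivext_quiver Q I)"
proof -
  let ?T = "trivext_quiver Q I"
  have T: "wf_digraph ?T" by (rule wf_digraph_trivext_quiver) fact
  obtain m n where m: "m \<in> maximal_paths Q I"
    and C: "C = (tail ?T (hd (rotate n (cycle_of m))), rotate n (cycle_of m))"
    using assms(2) by (auto simp: special_cycles_def)
  have "old_path m \<in> paths ?T" using m maximal_paths_subset by (auto simp: old_path_in_paths)
  then have "(fst m, cycle_of m) \<in> paths ?T"
    using m path_end_old_path[of Q I m]
    by (simp add: cycle_of_def old_path_def paths_append[OF T] paths_single[OF T])
  moreover have "path_end ?T (fst m, cycle_of m) = fst m"
    by (simp add: cycle_of_def path_end_conv)
  ultimately show ?thesis
    using rotate_closed_path[OF T] by (auto simp: C cycle_of_def)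
qed

lemma Inr_in_special_cycle: "C \<in> special_cycles Q I \<Longrightarrow> \<exists>m. Inr m \<in> set (snd C)"
  by (force simp: special_cycles_def cycle_of_def)

text \<open>A contiguous block that avoids \<open>z\<close> cannot straddle it.\<close>

lemma sublist_split_at:
  assumes "sublist zs (as @ z # bs)" "z \<notin> set zs"
  shows "sublist zs as \<or> sublist zs bs"
  using assms by (auto simp: sublist_append sublist_Cons_right prefix_Cons)

lemma sublist_of_map_inj:
  assumes "inj f" "sublist (map f xs) (map f ys)"
  shows "sublist xs ys"
proof -
  have "sublist (map (inv_into UNIV f) (map f xs)) (map (inv_into UNIV f) (map f ys))"
    using assms(2) by (rule map_mono_sublist)
  then show ?thesis using assms(1) by simp
qed

text \<open>A rotation of the cycle reads: a suffix of \<open>m\<close>, the only new arrow, the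
  complementary prefix of \<open>m\<close>. A block of old arrows lies in one of these two pieces of
  \<open>m\<close>.\<close>

lemma sublist_old_of_rotate_cycle_of:
  assumes "sublist (map Inl as) (rotate n (cycle_of m))"
  shows "sublist as (snd m)"
proof -
  \<comment> \<open>The cycle has one arrow more than \<open>m\<close>, so \<open>?k\<close> is at
    most the length of \<open>m\<close> and the cut never passes the new arrow.\<close>
  let ?k = "n mod length (cycle_of m)"
  have "?k < length (cycle_of m)" by (rule mod_less_divisor) (simp add: cycle_of_def)
  then have "rotate n (cycle_of m)
      = map Inl (drop ?k (snd m)) @ Inr m # map Inl (take ?k (snd m))"
    by (simp add: rotate_drop_take) (simp add: cycle_of_def drop_map take_map)
  then have "sublist (map Inl as) (map Inl (drop ?k (snd m)) :: ('b, 'a) trivext_arrow list)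
      \<or> sublist (map Inl as) (map Inl (take ?k (snd m)) :: ('b, 'a) trivext_arrow list)"
    using sublist_split_at[of "map Inl as" _ "Inr m"] assms by auto
  then have "sublist as (drop ?k (snd m)) \<or> sublist as (take ?k (snd m))"
    using sublist_of_map_inj[OF inj_Inl] by blast
  then show ?thesis
    using sublist_order.order_trans sublist_drop sublist_take by blast
qed


section \<open>Forgetting the new arrows\<close>

text \<open>The linear projection \<pi> of path algebras: the coefficient of \<open>p\<close> is the
  one found at \<open>old_path p\<close>.\<close>

abbreviation forget_new ::
  "(('v, ('v, 'a) trivext_arrow) path \<Rightarrow>\<^sub>0 'k::field) \<Rightarrow> (('v, 'a) path \<Rightarrow>\<^sub>0 'k)"
where
  "forget_new \<equiv> Poly_Mapping.map_key old_path"

lemma forget_new_single: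
  "forget_new (Poly_Mapping.single (old_path p) c) = Poly_Mapping.single p c"
  by (rule map_key_single[OF inj_old_path])

lemma forget_new_eq_0:
  "\<exists>m. Inr m \<in> set (snd q) \<Longrightarrow> forget_new (Poly_Mapping.single q c) = 0"
  by (rule map_key_single_notin_range[OF inj_old_path]) (simp add: path_notin_range_old_path)

text \<open>A concatenation contains a new arrow exactly when a factor does, and
  \<open>old_path\<close> preserves concatenation and end vertices.\<close>

lemma forget_new_path_mult:
  "forget_new (path_mult (trivext_quiver Q I) f g) = path_mult Q (forget_new f) (forget_new g)"
proof (induction f rule: poly_mapping_monomial_induct[OF subset_UNIV, case_names zero f_single add])
  case (f_single p a)
  show ?case
  proof (induction g rule: poly_mapping_monomial_induct[OF subset_UNIV, case_names zero g_single add])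
    case (g_single q b)
    show ?case
    proof (cases "p \<in> range old_path \<and> q \<in> range old_path")
      case True
      then obtain p' q' where pq: "p = old_path p'" "q = old_path q'" by auto
      have "(fst p, snd p @ snd q) = old_path (fst p', snd p' @ snd q')" "fst q = fst q'"
        by (simp_all add: pq old_path_def)
      then show ?thesis
        unfolding pq
        by (simp add: path_mult_single forget_new_single path_end_old_path map_key_zero[OF inj_old_path])
    next
      case False
      then have "\<exists>m. Inr m \<in> set (snd p @ snd q)"
        using path_notin_range_old_path[of p] path_notin_range_old_path[of q] by auto
      moreover have "forget_new (Poly_Mapping.single p a) = 0 \<or> forget_new (Poly_Mapping.single q b) = 0"
        using False map_key_single_notin_range[OF inj_old_path] by blast
      ultimately show ?thesis
        by (auto simp: path_mult_single forget_new_eq_0 map_key_zero[OF inj_old_path])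
    qed
  qed (simp_all add: path_mult_add_right map_key_plus[OF inj_old_path] map_key_zero[OF inj_old_path])
qed (simp_all add: path_mult_add_left map_key_plus[OF inj_old_path] map_key_zero[OF inj_old_path])

lemma ring_hom_ring_forget_new:
  assumes "wf_digraph Q" "finite (verts Q)"
  shows "ring_hom_ring (path_algebra (trivext_quiver Q I)) (path_algebra Q) forget_new"
proof (rule ring_hom_ringI)
  let ?T = "trivext_quiver Q I"
  show "ring (path_algebra ?T)" "ring (path_algebra Q)"
    using assms by (auto intro!: ring_path_algebra wf_digraph_trivext_quiver)
  \<comment> \<open>Both quivers have the same vertices, and trivial paths are embedded as trivial
    paths.\<close>
  have "forget_new (\<Sum>v\<in>verts Q. path_elt (v, [])) = (\<Sum>v\<in>verts Q. path_elt (v, []))"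
    unfolding map_key_sum[OF inj_old_path]
    by (rule sum.cong[OF refl]) (use forget_new_single[of "(_, [])" 1] in \<open>simp add: old_path_def\<close>)
  then show "forget_new \<one>\<^bsub>path_algebra ?T\<^esub> = \<one>\<^bsub>path_algebra Q\<^esub>" by simp
qed (auto simp: forget_new_path_mult map_key_plus[OF inj_old_path] keys_map_key[OF inj_old_path]
      dest!: subsetD[where B = "paths _"] simp flip: old_path_in_paths[of _ Q I])

lemma forget_new_surj:
  "forget_new ` carrier (path_algebra (trivext_quiver Q I)) = carrier (path_algebra Q)"
proof (intro equalityI subsetI)
  fix f assume "f \<in> forget_new ` carrier (path_algebra (trivext_quiver Q I))"
  then show "f \<in> carrier (path_algebra Q)"
    by (auto simp: keys_map_key[OF inj_old_path] simp flip: old_path_in_paths[of _ Q I])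
next
  fix f assume "f \<in> carrier (path_algebra Q)"
  then have "Poly_Mapping.keys f \<subseteq> paths Q" by simp
  then show "f \<in> forget_new ` carrier (path_algebra (trivext_quiver Q I))"
  proof (induction f rule: poly_mapping_monomial_induct)
    case zero
    show ?case by (rule image_eqI[of _ _ 0]) (simp_all add: map_key_zero[OF inj_old_path])
  next
    case (single p c)
    then show ?case
      by (intro image_eqI[of _ _ "Poly_Mapping.single (old_path p) c"])
        (simp_all add: forget_new_single old_path_in_paths)
  next
    case (add f g)
    then obtain f' g' where "f = forget_new f'" "g = forget_new g'"
      "Poly_Mapping.keys f' \<subseteq> paths (trivext_quiver Q I)" "Poly_Mapping.keys g' \<subseteq> paths (trivext_quiver Q I)"
      by auto
    then show ?case
      using keys_add[of f' g'] by (intro image_eqI[of _ _ "f' + g'"]) (auto simp: map_key_plus[OF inj_old_path])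
  qed
qed


section \<open>The cut algebra\<close>

lemma trivext_relations_iff:
  fixes Q :: "('v, 'a) pre_digraph" and I :: "(('v, 'a) path \<Rightarrow>\<^sub>0 'k::field) set"
  defines "T \<equiv> trivext_quiver Q I"
  shows "x \<in> trivext_relations Q I \<longleftrightarrow>
    (\<exists>C C'. x = path_elt C - path_elt C' \<and>
       C \<in> special_cycles Q I \<and> C' \<in> special_cycles Q I \<and> fst C = fst C') \<or>
    (\<exists>C. x = path_mult T (path_elt C) (arrow_elt T (hd (snd C))) \<and> C \<in> special_cycles Q I) \<or>
    (\<exists>a b. x = path_mult T (arrow_elt T a) (arrow_elt T b) \<and>
       a \<in> arcs T \<and> b \<in> arcs T \<and> \<not> (\<exists>C\<in>special_cycles Q I. sublist [a, b] (snd C)))"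
  unfolding trivext_relations_def Let_def T_def Un_iff mem_Collect_eq path_algebra_simps disj_assoc
  by (rule refl)

text \<open>One inclusion of the ideal comparison, checked on each of the three families of
  relations; admissibility enters through the extension to maximal paths.\<close>

lemma trivext_relations_subset_preimage:
  fixes Q :: "('v, 'a) pre_digraph" and I :: "(('v, 'a) path \<Rightarrow>\<^sub>0 'k::field) set"
  assumes "wf_digraph Q" "admissible_ideal Q I"
  shows "trivext_relations Q I
    \<subseteq> {x \<in> carrier (path_algebra (trivext_quiver Q I)). forget_new x \<in> I}"
proof
  let ?T = "trivext_quiver Q I"
  have T: "wf_digraph ?T" by (rule wf_digraph_trivext_quiver) fact
  have I: "ideal I (path_algebra Q)" using assms(2) by (simp add: admissible_ideal_def)
  have zero: "0 \<in> I"
    using additive_subgroup.zero_closed[OF ideal.axioms(1)[OF I]] by simp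
  have arrow: "Poly_Mapping.keys (arrow_elt ?T a :: _ \<Rightarrow>\<^sub>0 'k) \<subseteq> paths ?T" if "a \<in> arcs ?T" for a
    using that by (simp add: paths_single[OF T])
  fix x assume "x \<in> trivext_relations Q I"
  then consider
    (diff) C C' where "x = path_elt C - path_elt C'" "C \<in> special_cycles Q I" "C' \<in> special_cycles Q I"
  | (cycle) C where "x = path_mult ?T (path_elt C) (arrow_elt ?T (hd (snd C)))" "C \<in> special_cycles Q I"
  | (arrows) a b where "x = path_mult ?T (arrow_elt ?T a) (arrow_elt ?T b)" "a \<in> arcs ?T" "b \<in> arcs ?T"
      "\<not> (\<exists>C\<in>special_cycles Q I. sublist [a, b] (snd C))"
    unfolding trivext_relations_iff by blast
  then show "x \<in> {x \<in> carrier (path_algebra ?T). forget_new x \<in> I}"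
  proof cases
    case diff
    have "Poly_Mapping.keys x \<subseteq> paths ?T"
      using keys_diff[of "path_elt C" "path_elt C'"] special_cycle_in_paths[OF assms(1) diff(2)]
        special_cycle_in_paths[OF assms(1) diff(3)] by (auto simp: diff(1))
    moreover have "forget_new x = forget_new (path_elt C) - forget_new (path_elt C')"
      by (rule poly_mapping_eqI) (simp add: diff(1) map_key.rep_eq[OF inj_old_path] lookup_minus)
    ultimately show ?thesis
      using zero by (simp add: diff(2,3)[THEN Inr_in_special_cycle, THEN forget_new_eq_0])
  next
    case cycle
    have C: "C \<in> paths ?T" by (rule special_cycle_in_paths) fact+
    have "snd C \<noteq> []" using Inr_in_special_cycle[OF cycle(2)] by auto
    then have "hd (snd C) \<in> arcs ?T" using set_path_subset[OF C] hd_in_set by blast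
    then have "Poly_Mapping.keys x \<subseteq> paths ?T"
      unfolding cycle(1) using C by (intro path_mult_closed[OF T] arrow) auto
    then show ?thesis
      using zero by (simp add: cycle(1) forget_new_path_mult
          cycle(2)[THEN Inr_in_special_cycle, THEN forget_new_eq_0])
  next
    case arrows
    have carr: "Poly_Mapping.keys x \<subseteq> paths ?T"
      unfolding arrows(1) using arrows by (intro path_mult_closed[OF T] arrow)
    have "forget_new x \<in> I"
    proof (cases "\<exists>a' b'. a = Inl a' \<and> b = Inl b'")
      case True
      then obtain a' b' where ab: "a = Inl a'" "b = Inl b'" by auto
      \<comment> \<open>Two old arrows multiply to 0 unless composable, so a product outside
        \<open>I\<close> is a genuine path of length 2.\<close>
      have x: "forget_new x = (if head Q a' = tail Q b' then path_elt (tail Q a', [a', b']) else 0)"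
        using forget_new_single[of "(tail Q a', [a', b'])" "1 :: 'k"]
        by (simp add: arrows(1) ab path_mult_single path_end_conv old_path_def map_key_zero[OF inj_old_path])
      show ?thesis
      proof (rule ccontr)
        assume "forget_new x \<notin> I"
        then have eq: "head Q a' = tail Q b'" and notin: "path_elt (tail Q a', [a', b']) \<notin> I"
          using zero by (auto simp: x split: if_splits)
        have "(tail Q a', [a'] @ [b']) \<in> paths Q"
          using arrows(2,3) eq unfolding paths_append[OF assms(1)]
          by (auto simp: ab paths_single[OF assms(1)] path_end_conv)
        then obtain m where m: "m \<in> maximal_paths Q I" "sublist [a', b'] (snd m)"
          using nonzero_path_extends_to_maximal_path[OF assms _ notin] by auto
        have "sublist (map Inl [a', b']) (map Inl (snd m) :: ('v, 'a) trivext_arrow list)"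
          using m(2) by (rule map_mono_sublist)
        \<comment> \<open>Rotation by 0 exhibits \<open>cycle_of m\<close> itself as a special
          cycle, in which \<open>m\<close> occurs unbroken.\<close>
        then have "sublist [a, b] (rotate 0 (cycle_of m))"
          by (simp add: ab cycle_of_def sublist_append)
        moreover have "(tail ?T (hd (rotate 0 (cycle_of m))), rotate 0 (cycle_of m)) \<in> special_cycles Q I"
          unfolding special_cycles_def using m(1) by blast
        ultimately show False using arrows(4) by fastforce
      qed
    next
      case False
      then have "(\<exists>m. a = Inr m) \<or> (\<exists>m. b = Inr m)" by (metis sumE)
      then have "forget_new (arrow_elt ?T a) = (0 :: _ \<Rightarrow>\<^sub>0 'k) \<or> forget_new (arrow_elt ?T b) = (0 :: _ \<Rightarrow>\<^sub>0 'k)"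
        by (auto simp: forget_new_eq_0)
      then show ?thesis using zero by (auto simp: arrows(1) forget_new_path_mult)
    qed
    with carr show ?thesis by simp
  qed
qed

text \<open>The converse ingredient: the length 2 generators of \<open>I\<close> lift to relations
  of the third family. If such a path lay on a special cycle, it would lie in a maximal path, which
  would then belong to \<open>I\<close>.\<close>

lemma path_elt_in_trivext_relations:
  assumes "wf_digraph Q" "ideal I (path_algebra Q)"
    and "p \<in> paths Q" "length (snd p) = 2" "path_elt p \<in> I"
  shows "path_elt (old_path p) \<in> trivext_relations Q I"
proof -
  let ?T = "trivext_quiver Q I"
  obtain u a b where p: "p = (u, [a, b])"
    using assms(4) by (cases p) (auto simp: numeral_2_eq_2 length_Suc_conv)
  have ab: "a \<in> arcs Q" "u = tail Q a" "b \<in> arcs Q" "head Q a = tail Q b"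
    using assms(3) paths_append[OF assms(1), of u "[a]" "[b]"]
    by (auto simp: p paths_single[OF assms(1)] path_end_conv)
  have "\<not> sublist [Inl a, Inl b] (snd C)" if C: "C \<in> special_cycles Q I" for C
  proof
    assume "sublist [Inl a, Inl b] (snd C)"
    moreover obtain m n where m: "m \<in> maximal_paths Q I" "snd C = rotate n (cycle_of m)"
      using C by (auto simp: special_cycles_def)
    ultimately have "sublist [a, b] (snd m)"
      using sublist_old_of_rotate_cycle_of[of "[a, b]" n m] by simp
    then obtain as bs where m': "m = (fst m, as @ [a, b] @ bs)"
      by (metis prod.collapse sublist_def)
    have path: "(fst m, as @ [a, b] @ bs) \<in> paths Q"
      using m(1) m' maximal_paths_subset by (metis subsetD)
    \<comment> \<open>The occurrence of the two arrows inside \<open>m\<close> starts at the tail of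
      \<open>a\<close>, the vertex that \<open>ideal_superpath\<close> asks for.\<close>
    then have "path_end Q (fst m, as) = u"
      using paths_tail_hd[of "(path_end Q (fst m, as), [a, b] @ bs)" Q]
      by (simp add: paths_append[OF assms(1), of "fst m" as] ab)
    then have "path_elt (fst m, as @ [a, b] @ bs) \<in> I"
      using ideal_superpath[OF assms(1,2) _ path] assms(5) by (simp add: p)
    then show False using m(1) m' by (simp add: maximal_paths_def)
  qed
  moreover have "path_elt (old_path p) = path_mult ?T (arrow_elt ?T (Inl a)) (arrow_elt ?T (Inl b))"
    by (simp add: path_mult_single path_end_conv p old_path_def ab)
  ultimately show ?thesis
    unfolding trivext_relations_iff using ab
    by (intro disjI2 exI[of _ "Inl a"] exI[of _ "Inl b"]) simp
qed

text \<open>An element of the kernel is supported on paths through a new arrow, and each of these is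
  a multiple of that arrow. Hence any ideal \<open>J\<close> containing the new arrows contains the
  kernel.\<close>

lemma forget_new_kernel_subset:
  assumes "wf_digraph Q" "finite (verts Q)"
    and J: "ideal J (path_algebra (trivext_quiver Q I))"
    and D: "arrow_elt (trivext_quiver Q I) ` new_arrows Q I \<subseteq> J"
    and f: "Poly_Mapping.keys f \<subseteq> paths (trivext_quiver Q I)" "forget_new f = 0"
  shows "f \<in> J"
proof -
  let ?T = "trivext_quiver Q I"
  interpret J: ideal J "path_algebra ?T" by fact
  have T: "wf_digraph ?T" by (rule wf_digraph_trivext_quiver) fact
  \<comment> \<open>The support of \<open>forget_new f\<close> is the preimage of the support of
    \<open>f\<close> under \<open>old_path\<close>.\<close>
  have "old_path -` Poly_Mapping.keys f = {}"
    using keys_map_key[OF inj_old_path, of f] f(2) by simp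
  then have "Poly_Mapping.keys f \<subseteq> paths ?T - range old_path"
    using f(1) by auto
  then show ?thesis
  proof (induction f rule: poly_mapping_monomial_induct)
    case zero
    show ?case using additive_subgroup.zero_closed[OF J.is_additive_subgroup] by simp
  next
    case (single q c)
    then have q: "q \<in> paths ?T" by simp
    obtain m where m: "Inr m \<in> set (snd q)"
      using single path_notin_range_old_path[of q] by auto
    then obtain as bs where q': "q = (fst q, as @ [Inr m] @ bs)"
      by (metis prod.collapse split_list append_Cons append_Nil)
    have "Inr m \<in> new_arrows Q I"
      using m set_path_subset[OF q] by (auto simp: new_arrows_def)
    then have "arrow_elt ?T (Inr m) \<in> J" using D by blast
    moreover have path: "(fst q, as @ [Inr m] @ bs) \<in> paths ?T"
      using q q' by simp
    moreover have "path_end ?T (fst q, as) = tail ?T (Inr m)"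
      using path paths_tail_hd[of "(path_end ?T (fst q, as), [Inr m] @ bs)" ?T]
      by (simp add: paths_append[OF T, of "fst q" as])
    ultimately have "path_elt q \<in> J"
      using ideal_superpath[OF T J] q' by metis
    then have "Poly_Mapping.map ((*) c) (path_elt q) \<in> J"
      using assms(2) by (intro smult_closed_ideal[OF T _ J]) simp_all
    then show ?case by simp
  next
    case (add f g)
    have "f \<oplus>\<^bsub>path_algebra ?T\<^esub> g \<in> J"
      by (rule additive_subgroup.a_closed[OF J.is_additive_subgroup]) fact+
    then show ?case by simp
  qed
qed

lemma cut_ideal_eq_preimage:
  fixes Q :: "('v, 'a) pre_digraph" and I :: "(('v, 'a) path \<Rightarrow>\<^sub>0 'k::field) set"
  assumes "fin_digraph Q" "admissible_ideal Q I" "almost_gentle_S0 Q I"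
  defines "T \<equiv> trivext_quiver Q I"
  shows "Idl\<^bsub>path_algebra T\<^esub> (trivext_ideal Q I \<union> arrow_elt T ` new_arrows Q I)
    = {x \<in> carrier (path_algebra T). forget_new x \<in> I}" (is "?J = ?K")
proof
  have wf: "wf_digraph Q" "finite (verts Q)"
    using assms(1) by (simp_all add: fin_digraph_def fin_digraph_axioms_def)
  have T: "wf_digraph T" unfolding T_def by (rule wf_digraph_trivext_quiver) fact
  have I: "ideal I (path_algebra Q)" using assms(2) by (simp add: admissible_ideal_def)
  have zero: "0 \<in> I"
    using additive_subgroup.zero_closed[OF ideal.axioms(1)[OF I]] by simp
  have hom: "ring_hom_ring (path_algebra T) (path_algebra Q) forget_new"
    unfolding T_def by (rule ring_hom_ring_forget_new) fact+
  have K: "ideal ?K (path_algebra T)"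
    by (rule ring_hom_ring_preimage_ideal[OF hom I])
  interpret T: ring "path_algebra T"
    using T wf(2) by (intro ring_path_algebra) (simp_all add: T_def)
  have rel_K: "trivext_relations Q I \<subseteq> ?K"
    unfolding T_def by (rule trivext_relations_subset_preimage) fact+
  then have triv_K: "trivext_ideal Q I \<subseteq> ?K"
    unfolding trivext_ideal_def T_def[symmetric] by (rule T.genideal_minimal[OF K])
  have D_K: "arrow_elt T ` new_arrows Q I \<subseteq> ?K"
  proof
    fix x :: "_ \<Rightarrow>\<^sub>0 'k" assume "x \<in> arrow_elt T ` new_arrows Q I"
    then obtain m where "x = arrow_elt T (Inr m)" "m \<in> maximal_paths Q I"
      by (auto simp: new_arrows_def)
    then show "x \<in> ?K"
      using zero paths_single[OF T] by (auto simp: T_def forget_new_eq_0)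
  qed
  show "?J \<subseteq> ?K" using triv_K D_K by (intro T.genideal_minimal[OF K]) auto
  have gen: "trivext_ideal Q I \<union> arrow_elt T ` new_arrows Q I \<subseteq> carrier (path_algebra T)"
    using triv_K D_K by auto
  have J: "ideal ?J (path_algebra T)" by (rule T.genideal_ideal[OF gen])
  have D_J: "arrow_elt T ` new_arrows Q I \<subseteq> ?J"
    using T.genideal_self[OF gen] by blast
  have rel_J: "trivext_relations Q I \<subseteq> ?J"
  proof -
    have "trivext_relations Q I \<subseteq> carrier (path_algebra T)" using rel_K by blast
    then have "trivext_relations Q I \<subseteq> trivext_ideal Q I"
      unfolding trivext_ideal_def T_def by (rule T.genideal_self[unfolded T_def])
    then show ?thesis using T.genideal_self[OF gen] by blast
  qed
  \<comment> \<open>As the image is an ideal, it contains \<open>I\<close> as soon as it contains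
    the generators from \<rho>.\<close>
  have image: "ideal (forget_new ` ?J) (path_algebra Q)"
    by (rule ring_hom_ring_image_ideal[OF hom _ J]) (unfold T_def, rule forget_new_surj)
  obtain \<rho> where \<rho>: "\<rho> \<subseteq> {p \<in> paths Q. length (snd p) = 2}" "I = Idl\<^bsub>path_algebra Q\<^esub> (path_elt ` \<rho>)"
    using assms(3) by (auto simp: almost_gentle_S0_def)
  have "path_elt ` \<rho> \<subseteq> forget_new ` ?J"
  proof
    fix x :: "_ \<Rightarrow>\<^sub>0 'k" assume "x \<in> path_elt ` \<rho>"
    then obtain p where p: "x = path_elt p" "p \<in> \<rho>" by auto
    have "path_elt p \<in> I" unfolding \<rho>(2) genideal_def using p(2) by auto
    then have "path_elt (old_path p) \<in> ?J"
      using path_elt_in_trivext_relations[OF wf(1) I] p(2) \<rho>(1) rel_J by blast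
    then show "x \<in> forget_new ` ?J"
      unfolding p(1) forget_new_single[of p 1, symmetric] by (rule imageI)
  qed
  then have "Idl\<^bsub>path_algebra Q\<^esub> (path_elt ` \<rho>) \<subseteq> forget_new ` ?J"
    by (rule ring.genideal_minimal[OF ring_path_algebra[OF wf] image])
  then have I_J: "I \<subseteq> forget_new ` ?J"
    by (rule ord_eq_le_trans[OF \<rho>(2)])
  show "?K \<subseteq> ?J"
  proof
    fix x assume x: "x \<in> ?K"
    \<comment> \<open>Write \<open>x\<close> as \<open>(x - j) + j\<close>: the first summand is in
      the kernel of \<open>forget_new\<close>, hence in \<open>?J\<close>.\<close>
    then obtain j where j: "j \<in> ?J" "forget_new x = forget_new j" using I_J by auto
    interpret J: ideal ?J "path_algebra T" by (rule J)
    have "forget_new (x - j) = 0"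
      using map_key_plus[OF inj_old_path, of "x - j" j] j(2) by simp
    moreover have "Poly_Mapping.keys (x - j) \<subseteq> paths T"
      using keys_diff[of x j] x J.Icarr[OF j(1)] by auto
    ultimately have "x - j \<in> ?J"
      using forget_new_kernel_subset[OF wf J[unfolded T_def] D_J[unfolded T_def]]
      by (simp add: T_def)
    then have "(x - j) \<oplus>\<^bsub>path_algebra T\<^esub> j \<in> ?J"
      using j(1) by (rule additive_subgroup.a_closed[OF J.is_additive_subgroup])
    then show "x \<in> ?J" by simp
  qed
qed

section \<open>The new arrows as an admissible cut\<close>

lemma new_arrows_admissible_cut:
  assumes "cycle_representatives Q I R"
  shows "admissible_cut Q I R (new_arrows Q I)"
proof -
  \<comment> \<open>Rotation keeps the set of arrows, and \<open>cycle_of m\<close> contains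
    \<open>Inr m\<close> as its only new arrow.\<close>
  have inter: "\<exists>!a. a \<in> new_arrows Q I \<and> a \<in> set (snd C)" if C: "C \<in> R" for C
  proof -
    obtain m n where "m \<in> maximal_paths Q I" "snd C = rotate n (cycle_of m)"
      using C assms by (force simp: cycle_representatives_def special_cycles_def)
    then show ?thesis by (intro ex1I[of _ "Inr m"]) (auto simp: new_arrows_def cycle_of_def)
  qed
  have "\<exists>C\<in>R. Inr m \<in> set (snd C)" if m: "m \<in> maximal_paths Q I" for m
  proof -
    have "(tail (trivext_quiver Q I) (hd (rotate 0 (cycle_of m))), rotate 0 (cycle_of m)) \<in> special_cycles Q I"
      unfolding special_cycles_def using m by blast
    then obtain C n where "C \<in> R" "snd C = rotate n (rotate 0 (cycle_of m))"
      using assms unfolding cycle_representatives_def by (metis snd_conv)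
    then show ?thesis by (intro bexI[of _ C]) (simp_all add: cycle_of_def)
  qed
  with inter show ?thesis
    by (auto simp: admissible_cut_def new_arrows_def)
qed

theorem theorem5p3:
  fixes Q :: "('v, 'a) pre_digraph"
    and I :: "(('v, 'a) path \<Rightarrow>\<^sub>0 'k::field) set"
    and R :: "('v, ('v, 'a) trivext_arrow) path set"
  assumes "fin_digraph Q"
    and "admissible_ideal Q I"
    and "indecomposable_algebra (quotient_algebra (path_algebra Q) I)"
    and "almost_gentle Q I"
    and "cycle_representatives Q I R"
  shows "admissible_cut Q I R (new_arrows Q I) \<and>
         algebra_iso (cut_algebra Q I (new_arrows Q I)) (quotient_algebra (path_algebra Q) I)"
proof
  show "admissible_cut Q I R (new_arrows Q I)"
    by (rule new_arrows_admissible_cut) fact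
  have wf: "wf_digraph Q" "finite (verts Q)"
    using assms(1) by (simp_all add: fin_digraph_def fin_digraph_axioms_def)
  have I: "ideal I (path_algebra Q)" using assms(2) by (simp add: admissible_ideal_def)
  have S0: "almost_gentle_S0 Q I" using assms(4) by (simp add: almost_gentle_def)
  show "algebra_iso (cut_algebra Q I (new_arrows Q I)) (quotient_algebra (path_algebra Q) I)"
    \<comment> \<open>The cut ideal becomes the full preimage of \<open>I\<close> under the
      surjection \<open>forget_new\<close>, so the two quotients agree.\<close>
    unfolding cut_algebra_def Let_def cut_ideal_eq_preimage[OF assms(1,2) S0]
  proof (rule quotient_algebra_iso_preimage[OF ring_hom_ring_forget_new[OF wf] forget_new_surj I])
    show "c \<odot>\<^bsub>path_algebra Q\<^esub> x \<in> I" if "x \<in> I" for c x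
      using smult_closed_ideal[OF wf I that] by simp
  qed (auto simp: map_scale_add map_key_map[OF inj_old_path] intro: subsetD[OF keys_map_scale])
qed

end
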